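(* Let $n\ge 6$ be an even integer. Then $n$ is nice (that is, there exists a permutation $\sigma$ of $\{1,2,\ldots,n\}$ such that $\{1^{\sigma(1)},2^{\sigma(2)},\ldots,n^{\sigma(n)}\}$ is a complete residue system modulo $n$) if and only if $p:=n/2$ is prime and $p-1$ is squarefree.
   Context: An integer $n\ge 2$ is called nice if there exists a permutation $\sigma$ of $\{1,2,\ldots,n\}$ such that $\{1^{\sigma(1)},2^{\sigma(2)},\ldots,n^{\sigma(n)}\}$ is a complete residue system modulo $n$, i.e., every residue class modulo $n$ contains exactly one of the $n$ integers $i^{\sigma(i)}$, $i=1,\ldots,n$. A positive integer is squarefree if it is not divisible by the square of any prime (in particular, $1$ is squarefree). *)

theory Defs
  imports "HOL-Combinatorics.Permutations" "HOL-Computational_Algebra.Squarefree"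
    "HOL-Number_Theory.Number_Theory"
begin

text \<open>
  Completeness is counted by index, so that two indices with the same value \<open>a i\<close> (such as
  \<open>2 ^ 4 = 4 ^ 2\<close>) count as two members of the residue class of that value.
\<close>

definition complete_residue_family :: "nat \<Rightarrow> nat set \<Rightarrow> (nat \<Rightarrow> nat) \<Rightarrow> bool" where
  "complete_residue_family n I a \<longleftrightarrow> (\<forall>r :: int. \<exists>!i. i \<in> I \<and> [int (a i) = r] (mod int n))"

definition nice :: "nat \<Rightarrow> bool" where
  "nice n \<longleftrightarrow> n \<ge> 2 \<and>
     (\<exists>\<sigma>. \<sigma> permutes {1..n} \<and> complete_residue_family n {1..n} (\<lambda>i. i ^ \<sigma> i))"

end

theory Submission
  imports Defs
begin

text \<open>
  Niceness of \<open>n\<close> means that the residues modulo \<open>n\<close> can be matched with the exponents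
  \<open>1, \<dots>, n\<close>, each exponent used once, so that raising every residue to its own exponent permutes
  the residues (\<open>nice_iff_inj_on\<close>).

  Necessity rests on a shortage of suitable exponents. If \<open>q\<^sup>2\<close> divides \<open>n\<close> for a prime \<open>q\<close>, then a
  residue divisible by \<open>q\<close> exactly once is only reached with exponent \<open>1\<close>, and there are at least two such
  residues; hence \<open>n\<close> is squarefree. Next, raising to individual exponents maps the set of
  \<open>k\<close>-th powers modulo \<open>n\<close> into itself, so if it permutes all residues, it also permutes the
  \<open>k\<close>-th powers. A residue with an exponent divisible by \<open>q\<close> is therefore sent to a \<open>q\<close>-th power,
  hence was a \<open>q\<close>-th power already, hence is sent to a \<open>q\<^sup>2\<close>-th power, and so on. So there are at
  least as many \<open>q\<^sup>j\<close>-th powers as there are exponents divisible by \<open>q\<close>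
  (\<open>div_le_card_power_residues\<close>). Squares (\<open>j = 1\<close>, \<open>q = 2\<close>) are too rare if
  \<open>n = 2 a b\<close> with coprime odd \<open>a, b > 1\<close>, which makes \<open>p = n / 2\<close> a prime; and \<open>q\<^sup>2\<close>-th powers are
  too rare if \<open>q\<^sup>2\<close> divides \<open>p - 1\<close>.

  For sufficiency, let \<open>n = 2 p\<close> and let \<open>g\<close> be a primitive root modulo \<open>p\<close>. The odd and the even
  residues coprime to \<open>p\<close> are two copies of the powers of \<open>g\<close>, and raising to powers becomes
  multiplication of discrete logarithms modulo \<open>N = p - 1\<close>. Up to multiples of \<open>N\<close>, the exponents
  \<open>1, \<dots>, 2 N\<close> are two copies of the residues modulo \<open>N\<close>. So one needs multipliers \<open>\<sigma> (b, x)\<close> for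
  \<open>b\<close> in a two-element set and \<open>x\<close> modulo \<open>N\<close> that take every value twice, such that
  \<open>x \<mapsto> x * \<sigma> (b, x)\<close> is a permutation for each \<open>b\<close>. A single copy is in general impossible, since a cyclic
  group of even order has no complete mapping, but two copies suffice: the unit groups of prime
  fields admit an explicit solution (\<open>double_complete_mapping_add_mod\<close>), and solutions for two factors
  combine to one for the product (\<open>double_complete_mapping_Times\<close>), so the Chinese remainder
  theorem covers all squarefree \<open>N\<close>.
\<close>

section \<open>Niceness as injectivity on residues\<close>

lemma bij_betw_if_inj_on_card_eq:
  assumes "inj_on f A" "f ` A \<subseteq> B" "finite B" "card A = card B"
  shows "bij_betw f A B"
  using assms by (simp add: bij_betw_def card_image card_subset_eq)

lemma bij_betw_mod_atLeastAtMost: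
  assumes "n > 0"
  shows "bij_betw (\<lambda>i. i mod n) {1..n} {..<n::nat}"
proof (rule bij_betw_byWitness[where f' = "\<lambda>r. if r = 0 then n else r"])
  show "\<forall>a\<in>{1..n}. (if a mod n = 0 then n else a mod n) = a"
  proof
    fix a assume "a \<in> {1..n}"
    then show "(if a mod n = 0 then n else a mod n) = a"
      by (cases "a = n") auto
  qed
qed (use assms in auto)

lemma complete_residue_family_iff_inj_on:
  assumes "n > 0" "finite I" "card I = n"
  shows "complete_residue_family n I a \<longleftrightarrow> inj_on (\<lambda>i. a i mod n) I"
proof
  assume *: "complete_residue_family n I a"
  show "inj_on (\<lambda>i. a i mod n) I"
  proof (rule inj_onI)
    fix i j assume "i \<in> I" "j \<in> I" "a i mod n = a j mod n"
    then have "[int (a i) = int (a j)] (mod int n)"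
      by (metis cong_def cong_int_iff)
    with * \<open>i \<in> I\<close> \<open>j \<in> I\<close> show "i = j"
      unfolding complete_residue_family_def by (metis cong_refl)
  qed
next
  assume inj: "inj_on (\<lambda>i. a i mod n) I"
  then have bij: "bij_betw (\<lambda>i. a i mod n) I {..<n}"
    using assms by (intro bij_betw_if_inj_on_card_eq) auto
  show "complete_residue_family n I a"
    unfolding complete_residue_family_def
  proof
    fix r :: int
    have iff: "[int (a i) = r] (mod int n) \<longleftrightarrow> a i mod n = nat (r mod int n)" for i
      using assms(1) pos_mod_sign[of "int n" r]
      unfolding cong_def zmod_int[symmetric] by linarith
    have "nat (r mod int n) \<in> {..<n}"
      using assms(1) by (simp add: nat_less_iff)
    then have "nat (r mod int n) \<in> (\<lambda>i. a i mod n) ` I"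
      unfolding bij_betw_imp_surj_on[OF bij] .
    then obtain i where i: "i \<in> I" "a i mod n = nat (r mod int n)"
      by (elim imageE) (drule sym, blast)
    show "\<exists>!i. i \<in> I \<and> [int (a i) = r] (mod int n)"
      unfolding iff
    proof (rule ex1I[of _ i])
      show "j = i" if "j \<in> I \<and> a j mod n = nat (r mod int n)" for j
        using inj_onD[OF inj, of j i] that i by simp
    qed (use i in simp)
  qed
qed

text \<open>
  Indexing by the residues \<open>0, \<dots>, n - 1\<close> in place of \<open>1, \<dots>, n\<close> turns the map of the definition
  into a self-map of a finite set. Only \<open>n\<close> has to be renamed, to \<open>0\<close>.
\<close>

lemma nice_iff_inj_on:
  "nice n \<longleftrightarrow> n \<ge> 2 \<and>
     (\<exists>e. bij_betw e {..<n} {1..n} \<and> inj_on (\<lambda>r. r ^ e r mod n) {..<n})"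
proof (cases "n \<ge> 2")
  case False
  then show ?thesis by (simp add: nice_def)
next
  case True
  let ?m = "\<lambda>i. i mod n"
  have m: "bij_betw ?m {1..n} {..<n}"
    using True by (intro bij_betw_mod_atLeastAtMost) auto
  have family: "complete_residue_family n {1..n} (\<lambda>i. i ^ \<sigma> i)
      \<longleftrightarrow> inj_on (\<lambda>i. i ^ \<sigma> i mod n) {1..n}" for \<sigma>
    using True by (intro complete_residue_family_iff_inj_on) auto
  show ?thesis
  proof
    assume "nice n"
    then obtain \<sigma> where \<sigma>: "\<sigma> permutes {1..n}" and inj: "inj_on (\<lambda>i. i ^ \<sigma> i mod n) {1..n}"
      unfolding nice_def family by blast
    define w where "w = inv_into {1..n} ?m"
    have w: "bij_betw w {..<n} {1..n}"
      unfolding w_def by (rule bij_betw_inv_into[OF m])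
    have w_mod: "w r mod n = r" if "r < n" for r
      unfolding w_def using bij_betw_inv_into_right[OF m] that by auto
    have "bij_betw (\<sigma> \<circ> w) {..<n} {1..n}"
      using bij_betw_trans[OF w permutes_imp_bij[OF \<sigma>]] .
    moreover have "inj_on (\<lambda>r. r ^ (\<sigma> \<circ> w) r mod n) {..<n}"
    proof -
      have "inj_on ((\<lambda>i. i ^ \<sigma> i mod n) \<circ> w) {..<n}"
        using w inj by (intro comp_inj_on) (auto simp: bij_betw_def)
      moreover have "((\<lambda>i. i ^ \<sigma> i mod n) \<circ> w) r = r ^ (\<sigma> \<circ> w) r mod n" if "r \<in> {..<n}" for r
        using that w_mod[of r] by (metis comp_apply lessThan_iff power_mod)
      ultimately show ?thesis
        by (rule inj_on_cong[THEN iffD1, rotated])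
    qed
    ultimately show "n \<ge> 2 \<and> (\<exists>e. bij_betw e {..<n} {1..n} \<and> inj_on (\<lambda>r. r ^ e r mod n) {..<n})"
      using True by blast
  next
    assume "n \<ge> 2 \<and> (\<exists>e. bij_betw e {..<n} {1..n} \<and> inj_on (\<lambda>r. r ^ e r mod n) {..<n})"
    then obtain e where e: "bij_betw e {..<n} {1..n}" and inj: "inj_on (\<lambda>r. r ^ e r mod n) {..<n}"
      by blast
    define \<sigma> where "\<sigma> = (\<lambda>i. if i \<in> {1..n} then e (i mod n) else i)"
    have "bij_betw (e \<circ> ?m) {1..n} {1..n}"
      using bij_betw_trans[OF m e] .
    then have "bij_betw \<sigma> {1..n} {1..n}"
      by (rule bij_betw_cong[THEN iffD1, rotated]) (simp add: \<sigma>_def)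
    then have "\<sigma> permutes {1..n}"
      by (rule bij_imp_permutes) (auto simp: \<sigma>_def)
    moreover have "inj_on (\<lambda>i. i ^ \<sigma> i mod n) {1..n}"
    proof -
      have "inj_on ((\<lambda>r. r ^ e r mod n) \<circ> ?m) {1..n}"
        using m inj by (intro comp_inj_on) (auto simp: bij_betw_def)
      moreover have "((\<lambda>r. r ^ e r mod n) \<circ> ?m) i = i ^ \<sigma> i mod n" if "i \<in> {1..n}" for i
        using that by (simp add: power_mod \<sigma>_def)
      ultimately show ?thesis
        by (rule inj_on_cong[THEN iffD1, rotated])
    qed
    ultimately show "nice n"
      using True family unfolding nice_def by blast
  qed
qed

section \<open>Power residues\<close>

definition power_residues :: "nat \<Rightarrow> nat \<Rightarrow> nat set" where
  "power_residues k n = range (\<lambda>x. x ^ k mod n)"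

lemma power_residues_subset: "n > 0 \<Longrightarrow> power_residues k n \<subseteq> {..<n}"
  by (auto simp: power_residues_def)

lemma finite_power_residues: "n > 0 \<Longrightarrow> finite (power_residues k n)"
  using power_residues_subset finite_subset by blast

lemma inj_on_mod_coprime:
  assumes "coprime a b"
  shows "inj_on (\<lambda>x::nat. (x mod a, x mod b)) {..<a * b}"
proof (rule inj_onI)
  fix x y assume "x \<in> {..<a * b}" "y \<in> {..<a * b}" "(x mod a, x mod b) = (y mod a, y mod b)"
  moreover from this have "[x = y] (mod a * b)"
    using assms by (intro coprime_cong_mult_nat) (auto simp: cong_def)
  ultimately show "x = y"
    using cong_less_modulus_unique_nat by blast
qed

lemma card_power_residues_coprime_mult_le:
  assumes "coprime a b" "a > 0" "b > 0"
  shows "card (power_residues k (a * b)) \<le> card (power_residues k a) * card (power_residues k b)"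
proof -
  let ?h = "\<lambda>r::nat. (r mod a, r mod b)"
  have "inj_on ?h (power_residues k (a * b))"
    using inj_on_mod_coprime[OF assms(1)]
    by (rule inj_on_subset) (use assms power_residues_subset[of "a * b"] in auto)
  moreover have "?h ` power_residues k (a * b) \<subseteq> power_residues k a \<times> power_residues k b"
    by (auto simp: power_residues_def mod_mod_cancel)
  ultimately have "card (power_residues k (a * b)) \<le> card (power_residues k a \<times> power_residues k b)"
    using assms by (intro card_inj_on_le) (auto simp: finite_power_residues)
  then show ?thesis
    by (simp add: card_cartesian_product)
qed

text \<open>
  Since \<open>x\<close> and \<open>a - x\<close> have the same square, every square is already one of some
  \<open>x \<le> a / 2\<close>.
\<close>

lemma card_square_residues_le:
  assumes "odd a"
  shows "card (power_residues 2 a) \<le> (a + 1) div 2"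
proof -
  have pos: "a > 0" using assms by (cases a) auto
  have "power_residues 2 a \<subseteq> (\<lambda>x. x ^ 2 mod a) ` {..a div 2}"
  proof
    fix y assume "y \<in> power_residues 2 a"
    then obtain x where y: "y = (x mod a) ^ 2 mod a"
      by (auto simp: power_residues_def power_mod)
    show "y \<in> (\<lambda>x. x ^ 2 mod a) ` {..a div 2}"
    proof (cases "x mod a \<le> a div 2")
      case True
      with y show ?thesis by blast
    next
      case False
      define z where "z = a - x mod a"
      have le: "x mod a < a" using pos by simp
      have "[int z ^ 2 = (- int (x mod a)) ^ 2] (mod int a)"
        unfolding z_def using le by (intro cong_pow) (simp add: of_nat_diff cong_def)
      then have "[z ^ 2 = (x mod a) ^ 2] (mod a)"
        by (simp add: flip: cong_int_iff of_nat_power)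
      then have "y = z ^ 2 mod a"
        using y by (simp add: cong_def)
      moreover have "z \<le> a div 2"
        using False le assms unfolding z_def by (auto elim!: oddE)
      ultimately show ?thesis by blast
    qed
  qed
  then have "card (power_residues 2 a) \<le> card {..a div 2}"
    by (meson card_image_le card_mono finite_atMost finite_imageI le_trans)
  also have "\<dots> = (a + 1) div 2"
    using assms by auto
  finally show ?thesis .
qed

text \<open>
  The next two lemmas make discrete logarithms available: exponents of a primitive root matter
  exactly modulo \<open>p - 1\<close>, and every unit has one.
\<close>

lemma primroot_power_cong_iff:
  assumes "prime p" "residue_primroot p g"
  shows "[g ^ i = g ^ j] (mod p) \<longleftrightarrow> [i = j] (mod p - 1)"
  using assms order_divides_expdiff[of p g i j]
  by (simp add: residue_primroot_def totient_prime)

lemma primroot_power_cong: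
  assumes "prime p" "residue_primroot p g" "\<not> p dvd x"
  obtains i where "i < p - 1" "[g ^ i = x] (mod p)"
proof -
  have "x mod p \<in> totatives p"
    using assms(1,3) prime_gt_0_nat[OF assms(1)]
    by (auto simp: totatives_prime dvd_eq_mod_eq_0)
  then have "x mod p \<in> (\<lambda>i. g ^ i mod p) ` {..<p - 1}"
    using residue_primroot_is_generator[OF _ assms(2)] prime_gt_1_nat[OF assms(1)]
    by (simp add: bij_betw_def totient_prime[OF assms(1)])
  then obtain i where "i < p - 1" "x mod p = g ^ i mod p" by blast
  then show ?thesis by (intro that) (auto simp: cong_def)
qed

text \<open>
  A nonzero \<open>k\<close>-th power is a power of \<open>g\<^sup>k\<close>, which has order \<open>t\<close>; the remaining \<open>1\<close> accounts for \<open>0\<close>.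
\<close>

lemma card_power_residues_prime_le:
  assumes "prime p" "p - 1 = k * t" "k > 0"
  shows "card (power_residues k p) \<le> t + 1"
proof -
  obtain g where g: "residue_primroot p g"
    using prime_primitive_root_exists assms(1) by (metis cyclic_moduli_def prime_gt_1_nat)
  have "power_residues k p \<subseteq> insert 0 ((\<lambda>j. g ^ (k * j) mod p) ` {..<t})"
  proof
    fix y assume "y \<in> power_residues k p"
    then obtain x where y: "y = x ^ k mod p"
      by (auto simp: power_residues_def)
    show "y \<in> insert 0 ((\<lambda>j. g ^ (k * j) mod p) ` {..<t})"
    proof (cases "p dvd x")
      case True
      then have "p dvd x ^ k" using assms(3) by (simp add: dvd_power_le dvd_trans)
      with y show ?thesis by simp
    next
      case False
      obtain i where i: "[g ^ i = x] (mod p)"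
        using primroot_power_cong[OF assms(1) g False] by blast
      have t: "t > 0"
        using assms(2) prime_gt_1_nat[OF assms(1)] by (auto intro!: Nat.gr0I)
      have "[k * i = k * (i mod t)] (mod p - 1)"
        by (metis assms(2) cong_def mod_mod_trivial mult_mod_right)
      then have "[g ^ (k * i) = g ^ (k * (i mod t))] (mod p)"
        using primroot_power_cong_iff[OF assms(1) g] by blast
      moreover have "[g ^ (k * i) = x ^ k] (mod p)"
        using cong_pow[OF i, of k] by (simp add: mult.commute flip: power_mult)
      ultimately have "y = g ^ (k * (i mod t)) mod p"
        unfolding y by (simp add: cong_def)
      moreover have "i mod t < t" using t by simp
      ultimately show ?thesis by blast
    qed
  qed
  then have "card (power_residues k p) \<le> card (insert 0 ((\<lambda>j. g ^ (k * j) mod p) ` {..<t}))"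
    by (intro card_mono) auto
  also have "\<dots> \<le> Suc (card ((\<lambda>j. g ^ (k * j) mod p) ` {..<t}))"
    by (rule card_insert_le_m1) auto
  also have "\<dots> \<le> t + 1"
    using card_image_le[of "{..<t}"] by simp
  finally show ?thesis .
qed

section \<open>Necessity\<close>

lemma bij_betw_power_residues:
  assumes "n > 0" "inj_on (\<lambda>r. r ^ e r mod n) {..<n}"
  shows "bij_betw (\<lambda>r. r ^ e r mod n) (power_residues k n) (power_residues k n)"
proof (rule bij_betw_if_inj_on_card_eq)
  show "inj_on (\<lambda>r. r ^ e r mod n) (power_residues k n)"
    by (rule inj_on_subset[OF assms(2) power_residues_subset[OF assms(1)]])
  show "(\<lambda>r. r ^ e r mod n) ` power_residues k n \<subseteq> power_residues k n"
  proof clarify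
    fix r assume "r \<in> power_residues k n"
    then obtain c where "r = c ^ k mod n" by (auto simp: power_residues_def)
    then have "r ^ e r mod n = (c ^ k) ^ e r mod n"
      by (simp add: power_mod[of "c ^ k" n])
    also have "(c ^ k) ^ e r = (c ^ e r) ^ k"
      by (simp only: mult.commute flip: power_mult)
    finally show "r ^ e r mod n \<in> power_residues k n"
      by (auto simp: power_residues_def)
  qed
qed (use assms in \<open>auto simp: finite_power_residues\<close>)

text \<open>
  The key step: if \<open>r ^ e r\<close> is a \<open>k\<close>-th power, then some \<open>k\<close>-th power is sent to it as well, because
  the \<open>k\<close>-th powers are permuted among themselves. By injectivity \<open>r\<close> is that \<open>k\<close>-th power, and
  an exponent divisible by \<open>q\<close> then yields a \<open>k q\<close>-th power. Iterating this gains a factor \<open>q\<close>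
  each time.
\<close>

lemma power_residue_if_dvd_exponent:
  assumes "n > 0" "inj_on (\<lambda>r. r ^ e r mod n) {..<n}" "r < n" "q dvd e r"
  shows "r ^ e r mod n \<in> power_residues (q ^ j) n"
proof (induction j)
  case 0
  have "r ^ e r mod n = (r ^ e r) ^ (q ^ 0) mod n" by simp
  then show ?case unfolding power_residues_def by blast
next
  case (Suc j)
  let ?f = "\<lambda>r. r ^ e r mod n"
  have "?f r \<in> ?f ` power_residues (q ^ j) n"
    using Suc bij_betw_power_residues[OF assms(1,2), of "q ^ j"] by (simp add: bij_betw_def)
  then obtain r' where r': "r' \<in> power_residues (q ^ j) n" "?f r = ?f r'" by blast
  moreover have "r' < n"
    using r'(1) power_residues_subset[OF assms(1)] by blast
  ultimately have "r = r'"
    using assms(2,3) by (auto dest: inj_onD)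
  with r'(1) obtain c where c: "r = c ^ (q ^ j) mod n"
    by (auto simp: power_residues_def)
  obtain d where d: "e r = q * d" using assms(4) by blast
  have "?f r = (c ^ d) ^ (q ^ Suc j) mod n"
    unfolding d by (subst c) (simp add: power_mod mult_ac flip: power_mult)
  then show ?case unfolding power_residues_def by blast
qed

text \<open>
  The left-hand side counts the multiples of \<open>q\<close> among the exponents \<open>1, \<dots>, n\<close>.
\<close>

lemma div_le_card_power_residues:
  assumes "n > 0" "bij_betw e {..<n} {1..n}" "inj_on (\<lambda>r. r ^ e r mod n) {..<n}" "q > 0"
  shows "n div q \<le> card (power_residues (q ^ j) n)"
proof -
  \<comment> \<open>\<open>w (q * i)\<close> is the residue that is raised to the exponent \<open>q * i\<close>.\<close>
  define w where "w = inv_into {..<n} e"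
  have w: "bij_betw w {1..n} {..<n}" and e_w: "\<And>d. d \<in> {1..n} \<Longrightarrow> e (w d) = d"
    unfolding w_def using assms(2) by (auto intro: bij_betw_inv_into bij_betw_inv_into_right)
  let ?F = "(\<lambda>r. r ^ e r mod n) \<circ> w \<circ> (\<lambda>i. q * i)"
  have sub: "q * i \<in> {1..n}" if "i \<in> {1..n div q}" for i
  proof -
    have "q * i \<le> q * (n div q)" using that by (intro mult_le_mono2) simp
    also have "\<dots> \<le> n" by simp
    finally show ?thesis using that assms(4) by (simp add: Suc_le_eq)
  qed
  have w_less: "w (q * i) < n" if "i \<in> {1..n div q}" for i
    using bij_betwE[OF w] sub[OF that] by blast
  have "inj_on ?F {1..n div q}"
  proof (rule inj_onI)
    fix i j assume i: "i \<in> {1..n div q}" and j: "j \<in> {1..n div q}" and "?F i = ?F j"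
    then have "w (q * i) = w (q * j)"
      using inj_onD[OF assms(3), of "w (q * i)" "w (q * j)"] w_less by simp
    then have "q * i = q * j"
      using e_w[OF sub[OF i]] e_w[OF sub[OF j]] by metis
    then show "i = j" using assms(4) by simp
  qed
  moreover have "?F ` {1..n div q} \<subseteq> power_residues (q ^ j) n"
  proof clarify
    fix i assume i: "i \<in> {1..n div q}"
    have "q dvd e (w (q * i))"
      unfolding e_w[OF sub[OF i]] by simp
    then show "?F i \<in> power_residues (q ^ j) n"
      using power_residue_if_dvd_exponent[OF assms(1,3) w_less[OF i]] by simp
  qed
  ultimately have "card {1..n div q} \<le> card (power_residues (q ^ j) n)"
    by (intro card_inj_on_le[OF _ _ finite_power_residues[OF assms(1)]])
  then show ?thesis by simp
qed

lemma coprime_if_squarefree_mult: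
  fixes a b :: nat
  assumes "squarefree (a * b)"
  shows "coprime a b"
proof (rule coprimeI)
  fix d assume "d dvd a" "d dvd b"
  then have "d ^ 2 dvd a * b" by (simp add: power2_eq_square mult_dvd_mono)
  with assms show "is_unit d" by (rule squarefreeD)
qed

lemma exponent_eq_1_if_exact_divisor:
  assumes "prime q" "q ^ 2 dvd n" "q dvd x ^ k mod n" "\<not> q ^ 2 dvd x ^ k mod (n::nat)"
  shows "k = 1"
proof -
  have "q dvd n" using assms(2) by (meson dvd_power dvd_trans pos2)
  then have "q dvd x ^ k" "\<not> q ^ 2 dvd x ^ k"
    using assms by (auto simp: dvd_mod_iff)
  then have "q dvd x"
    using assms(1) prime_dvd_power by blast
  have "k < 2"
  proof (rule ccontr)
    assume "\<not> k < 2"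
    then have "q ^ 2 dvd x ^ k"
      using \<open>q dvd x\<close> by (intro dvd_power_le) auto
    with \<open>\<not> q ^ 2 dvd x ^ k\<close> show False by blast
  qed
  moreover have "k \<noteq> 0"
    using \<open>q dvd x ^ k\<close> prime_gt_1_nat[OF assms(1)] by (intro notI) simp
  ultimately show ?thesis by simp
qed

text \<open>
  All residues divisible by \<open>q\<close> exactly once would need the exponent \<open>1\<close>, so there could only be
  one of them. But \<open>q\<close> and \<open>2 q\<close> are two such residues for odd \<open>q\<close>, and \<open>2\<close> and \<open>6\<close> are for \<open>q = 2\<close>,
  where \<open>4\<close> divides \<open>n \<ge> 6\<close>, so that \<open>n \<ge> 8\<close>. (The bound excludes
  \<open>n = 4\<close>, which is nice.)
\<close>

lemma squarefree_if_nice: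
  assumes "nice n" "n \<ge> 6"
  shows "squarefree n"
proof (rule ccontr)
  assume "\<not> squarefree n"
  then obtain q where q: "prime q" "q ^ 2 dvd n"
    using assms(2) by (auto simp: squarefree_factorial_semiring)
  obtain e where e: "bij_betw e {..<n} {1..n}" and inj: "inj_on (\<lambda>r. r ^ e r mod n) {..<n}"
    using assms(1) by (auto simp: nice_iff_inj_on)
  have image: "(\<lambda>r. r ^ e r mod n) ` {..<n} = {..<n}"
    using inj assms(2) by (intro endo_inj_surj) auto
  have preimage: "\<exists>x<n. u = x ^ e x mod n" if "u < n" for u
  proof -
    have "u \<in> (\<lambda>r. r ^ e r mod n) ` {..<n}" unfolding image using that by simp
    then show ?thesis by blast
  qed
  have unique: "u = v" if "u < n" "v < n" "q dvd u" "\<not> q ^ 2 dvd u" "q dvd v" "\<not> q ^ 2 dvd v" for u v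
  proof -
    obtain x y where x: "x < n" "u = x ^ e x mod n" and y: "y < n" "v = y ^ e y mod n"
      using preimage \<open>u < n\<close> \<open>v < n\<close> by blast
    have "e x = 1" "e y = 1"
      using exponent_eq_1_if_exact_divisor[OF q that(3,4)[unfolded x(2)]]
        exponent_eq_1_if_exact_divisor[OF q that(5,6)[unfolded y(2)]] by simp_all
    then have "x = y"
      using inj_onD[OF bij_betw_imp_inj_on[OF e], of x y] x(1) y(1) by simp
    then show ?thesis using x y by simp
  qed
  have "q ^ 2 \<le> n"
    using q(2) assms(2) by (intro dvd_imp_le) auto
  show False
  proof (cases "q = 2")
    case True
    then have "4 dvd n" using q(2) by simp
    then have "n \<ge> 8" using assms(2) by presburger
    then show False
      using unique[of 2 6] True by (auto dest: dvd_imp_le)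
  next
    case False
    then have "q \<ge> 3" using prime_ge_2_nat[OF q(1)] by simp
    then have "2 * q < q ^ 2" "q > 0" by (auto simp: power2_eq_square)
    moreover from this have "\<not> q ^ 2 dvd q" "\<not> q ^ 2 dvd 2 * q"
      using nat_dvd_not_less[of q "q ^ 2"] nat_dvd_not_less[of "2 * q" "q ^ 2"] by simp_all
    ultimately show False
      using unique[of q "2 * q"] \<open>q ^ 2 \<le> n\<close> by simp
  qed
qed

text \<open>
  Half of the exponents are even, so at least \<open>m = n / 2\<close> residues modulo \<open>n\<close> are squares. If
  \<open>m = a b\<close> with coprime odd \<open>a, b \<ge> 3\<close>, the Chinese remainder theorem leaves at most
  \<open>2 * (a + 1) / 2 * (b + 1) / 2\<close> squares, which is less than \<open>a b\<close> because \<open>(a - 1) (b - 1) > 2\<close>.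
\<close>

lemma prime_half_if_nice:
  assumes "nice n" "n \<ge> 6" "even n"
  shows "prime (n div 2)"
proof (rule ccontr)
  assume not_prime: "\<not> prime (n div 2)"
  define m where "m = n div 2"
  have n: "n = 2 * m" using assms(3) by (simp add: m_def)
  have "squarefree (2 * m)"
    using squarefree_if_nice[OF assms(1,2)] n by simp
  then have "coprime 2 m" and sf: "squarefree m"
    using coprime_if_squarefree_mult squarefree_multD by blast+
  then have "odd m" by simp
  have "m \<ge> 3" using assms(2) n by simp
  then obtain a where a: "prime a" "a dvd m"
    using prime_factor_nat[of m] by auto
  then obtain b where m: "m = a * b" by blast
  have "coprime a b" using sf coprime_if_squarefree_mult m by blast
  have odd: "odd a" "odd b" using \<open>odd m\<close> m by auto
  have "b \<noteq> 1" using not_prime a m m_def by auto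
  then have ge: "a \<ge> 3" "b \<ge> 3"
    using odd prime_gt_1_nat[OF a(1)] by presburger+
  obtain e where e: "bij_betw e {..<n} {1..n}" and inj: "inj_on (\<lambda>r. r ^ e r mod n) {..<n}"
    using assms(1) by (auto simp: nice_iff_inj_on)
  have "m \<le> card (power_residues 2 n)"
    using div_le_card_power_residues[OF _ e inj, of 2 1] assms(2) m_def by simp
  also have "\<dots> \<le> card (power_residues 2 2) * card (power_residues 2 m)"
    unfolding n using \<open>coprime 2 m\<close> \<open>m \<ge> 3\<close> by (intro card_power_residues_coprime_mult_le) auto
  also have "\<dots> \<le> 2 * (card (power_residues 2 a) * card (power_residues 2 b))"
  proof (rule mult_mono)
    show "card (power_residues 2 2) \<le> 2"
      using card_mono[OF _ power_residues_subset[of 2 2]] by simp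
    show "card (power_residues 2 m) \<le> card (power_residues 2 a) * card (power_residues 2 b)"
      unfolding m using \<open>coprime a b\<close> ge by (intro card_power_residues_coprime_mult_le) auto
  qed auto
  also have "\<dots> \<le> 2 * ((a + 1) div 2 * ((b + 1) div 2))"
    using odd by (intro mult_left_mono mult_mono card_square_residues_le) auto
  finally have le: "a * b \<le> 2 * ((a + 1) div 2 * ((b + 1) div 2))" using m by simp
  obtain a' b' where ab: "a = 2 * a' + 1" "b = 2 * b' + 1"
    using odd by (auto elim!: oddE)
  have "a' \<ge> 1" "b' \<ge> 1" using ge ab by auto
  \<comment> \<open>With \<open>a = 2 * a'' + 3\<close> and \<open>b = 2 * b'' + 3\<close>, every coefficient of \<open>a * b\<close> exceeds the
    corresponding one on the right-hand side of \<open>le\<close>.\<close>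
  then obtain a'' b'' where "a' = a'' + 1" "b' = b'' + 1"
    by (metis add.commute le_Suc_ex)
  then show False using le ab by (simp add: algebra_simps)
qed

text \<open>
  With \<open>p - 1 = q\<^sup>2 t\<close> there are at most \<open>2 (t + 1)\<close> residues modulo \<open>2 p\<close> that are \<open>q\<^sup>2\<close>-th powers, while
  \<open>2 q t + 2 div q\<close> of the numbers from \<open>1\<close> to \<open>2 p = 2 q\<^sup>2 t + 2\<close> are multiples of \<open>q\<close>. For \<open>q \<ge> 3\<close>
  the term \<open>2 div q\<close> vanishes; for \<open>q = 2\<close> it is needed to exclude \<open>p = 5\<close>.
\<close>

lemma squarefree_half_minus_1_if_nice:
  assumes "nice (2 * p)" "prime p" "odd p"
  shows "squarefree (p - 1)"
proof (rule squarefreeI)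
  fix q assume "q ^ 2 dvd p - 1"
  then obtain t where t: "p - 1 = q ^ 2 * t" by blast
  have "p \<ge> 3" using assms(2,3) prime_ge_2_nat[of p] by presburger
  then have pos: "q > 0" "t > 0" using t by (auto intro!: Nat.gr0I)
  obtain e where e: "bij_betw e {..<2 * p} {1..2 * p}"
      and inj: "inj_on (\<lambda>r. r ^ e r mod (2 * p)) {..<2 * p}"
    using assms(1) by (auto simp: nice_iff_inj_on)
  have p: "2 * p = 2 + q * (2 * q * t)"
    using t \<open>p \<ge> 3\<close> by (simp add: power2_eq_square)
  have "2 * q * t + 2 div q = 2 * p div q"
    unfolding p using pos(1) by (intro div_mult_self2[symmetric]) simp
  also have "\<dots> \<le> card (power_residues (q ^ 2) (2 * p))"
    using div_le_card_power_residues[OF _ e inj, of q 2] pos \<open>p \<ge> 3\<close> by simp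
  also have "\<dots> \<le> card (power_residues (q ^ 2) 2) * card (power_residues (q ^ 2) p)"
    using assms(3) \<open>p \<ge> 3\<close> by (intro card_power_residues_coprime_mult_le) auto
  also have "\<dots> \<le> 2 * (t + 1)"
  proof (rule mult_mono)
    show "card (power_residues (q ^ 2) 2) \<le> 2"
      using card_mono[OF _ power_residues_subset[of 2 "q ^ 2"]] by simp
    show "card (power_residues (q ^ 2) p) \<le> t + 1"
      using assms(2) t pos by (intro card_power_residues_prime_le) auto
  qed auto
  finally have le: "2 * q * t + 2 div q \<le> 2 * (t + 1)" .
  have "\<not> q \<ge> 3"
  proof
    assume "q \<ge> 3"
    then have "3 * t \<le> q * t" by simp
    also have "q * t \<le> t + 1"
      using add_leD1[OF le] by simp
    finally show False using pos by simp
  qed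
  moreover have "q \<noteq> 2" using le pos by auto
  ultimately show "is_unit q" using pos by simp
qed

section \<open>Complete mappings on two copies\<close>

text \<open>
  A complete mapping of a group is a bijection \<open>\<sigma>\<close> for which \<open>x \<mapsto> x * \<sigma> x\<close> is a bijection, too. Here
  \<open>\<sigma> = snd \<circ> T\<close> is defined on two copies of \<open>A\<close> and takes every value twice, and the product is to be
  a bijection on each copy. That every value is taken twice is expressed by the label \<open>fst \<circ> T\<close>,
  which tells the two occurrences apart; it makes \<open>T\<close> a bijection, and bijections can
  be composed.
\<close>

definition has_double_complete_mapping :: "'a set \<Rightarrow> ('a \<Rightarrow> 'a \<Rightarrow> 'a) \<Rightarrow> bool" where
  "has_double_complete_mapping A f \<longleftrightarrow> (\<exists>T :: bool \<times> 'a \<Rightarrow> bool \<times> 'a.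
     bij_betw T (UNIV \<times> A) (UNIV \<times> A) \<and> (\<forall>b. bij_betw (\<lambda>x. f x (snd (T (b, x)))) A A))"

lemma double_complete_mappingE:
  fixes A :: "'a set"
  assumes "has_double_complete_mapping A f"
  obtains T :: "bool \<times> 'a \<Rightarrow> bool \<times> 'a"
  where "bij_betw T (UNIV \<times> A) (UNIV \<times> A)"
    and "\<And>b x. x \<in> A \<Longrightarrow> snd (T (b, x)) \<in> A"
    and "\<And>b. bij_betw (\<lambda>x. f x (snd (T (b, x)))) A A"
proof -
  obtain T :: "bool \<times> 'a \<Rightarrow> bool \<times> 'a" where T: "bij_betw T (UNIV \<times> A) (UNIV \<times> A)"
      and out: "\<forall>b. bij_betw (\<lambda>x. f x (snd (T (b, x)))) A A"
    using assms unfolding has_double_complete_mapping_def by (elim exE conjE)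
  have "snd (T (b, x)) \<in> A" if "x \<in> A" for b x
    using bij_betwE[OF T, rule_format, of "(b, x)"] that by (auto simp: mem_Times_iff)
  then show ?thesis using that[OF T _ out[rule_format]] by blast
qed

lemma double_complete_mapping_image:
  fixes A :: "'a set" and B :: "'b set"
  assumes "has_double_complete_mapping A f" "bij_betw h A B"
    and hom: "\<And>x y. x \<in> A \<Longrightarrow> y \<in> A \<Longrightarrow> h (f x y) = g (h x) (h y)"
  shows "has_double_complete_mapping B g"
proof -
  obtain T :: "bool \<times> 'a \<Rightarrow> bool \<times> 'a" where T: "bij_betw T (UNIV \<times> A) (UNIV \<times> A)"
      and T_mem: "\<And>b x. x \<in> A \<Longrightarrow> snd (T (b, x)) \<in> A"
      and out: "\<And>b. bij_betw (\<lambda>x. f x (snd (T (b, x)))) A A"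
    by (rule double_complete_mappingE[OF assms(1)]) (rule that)
  define w where "w = inv_into A h"
  have w: "bij_betw w B A" and h_w: "\<And>y. y \<in> B \<Longrightarrow> h (w y) = y"
    unfolding w_def using assms(2) by (auto intro: bij_betw_inv_into bij_betw_inv_into_right)
  let ?T = "map_prod id h \<circ> (T \<circ> map_prod id w)"
  have "bij_betw (map_prod id h) ((UNIV :: bool set) \<times> A) (UNIV \<times> B)"
       "bij_betw (map_prod id w) ((UNIV :: bool set) \<times> B) (UNIV \<times> A)"
    using assms(2) w by (auto intro!: bij_betw_map_prod)
  then have "bij_betw ?T (UNIV \<times> B) (UNIV \<times> B)"
    using T by (meson bij_betw_trans)
  moreover have "bij_betw (\<lambda>y. g y (snd (?T (b, y)))) B B" for b
  proof -
    have "bij_betw (h \<circ> ((\<lambda>x. f x (snd (T (b, x)))) \<circ> w)) B B"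
      using w out assms(2) by (meson bij_betw_trans)
    moreover have "(h \<circ> ((\<lambda>x. f x (snd (T (b, x)))) \<circ> w)) y = g y (snd (?T (b, y)))" if "y \<in> B" for y
      using that w T_mem by (auto simp: hom h_w bij_betw_def)
    ultimately show ?thesis by (simp cong: bij_betw_cong)
  qed
  ultimately show ?thesis unfolding has_double_complete_mapping_def by blast
qed

text \<open>
  This passes from a group to the group with a zero adjoined, that is, from the units of a field
  to its multiplicative monoid.
\<close>

lemma double_complete_mapping_insert:
  fixes A :: "'a set"
  assumes "has_double_complete_mapping A f" "z \<notin> A" "f z z = z"
  shows "has_double_complete_mapping (insert z A) f"
proof -
  obtain T :: "bool \<times> 'a \<Rightarrow> bool \<times> 'a" where T: "bij_betw T (UNIV \<times> A) (UNIV \<times> A)"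
      and T_mem: "\<And>b x. x \<in> A \<Longrightarrow> snd (T (b, x)) \<in> A"
      and out: "\<And>b. bij_betw (\<lambda>x. f x (snd (T (b, x)))) A A"
    by (rule double_complete_mappingE[OF assms(1)]) (rule that)
  define T' where "T' = (\<lambda>(b, x). if x = z then (b, z) else T (b, x))"
  have "bij_betw T' (UNIV \<times> A) (UNIV \<times> A)"
    using T by (rule bij_betw_cong[THEN iffD1, rotated]) (use assms(2) in \<open>auto simp: T'_def\<close>)
  moreover have "bij_betw T' (UNIV \<times> {z}) (UNIV \<times> {z})"
    by (rule bij_betw_cong[THEN iffD1, OF _ bij_betw_id]) (auto simp: T'_def)
  ultimately have "bij_betw T' (UNIV \<times> A \<union> UNIV \<times> {z}) (UNIV \<times> A \<union> UNIV \<times> {z})"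
    using assms(2) by (intro bij_betw_combine) auto
  moreover have "UNIV \<times> A \<union> UNIV \<times> {z} = (UNIV :: bool set) \<times> insert z A" by auto
  moreover have "bij_betw (\<lambda>x. f x (snd (T' (b, x)))) (insert z A) (insert z A)" for b
  proof -
    have "bij_betw (\<lambda>x. f x (snd (T' (b, x)))) A A"
      using out[of b] by (rule bij_betw_cong[THEN iffD1, rotated]) (use assms(2) in \<open>auto simp: T'_def\<close>)
    moreover have "f z (snd (T' (b, z))) = z"
      by (simp add: T'_def assms(3))
    ultimately show ?thesis
      using assms(2) notIn_Un_bij_betw3[of z A "\<lambda>x. f x (snd (T' (b, x)))" A] by simp
  qed
  ultimately show ?thesis unfolding has_double_complete_mapping_def by metis
qed

text \<open>
  The label produced by the solution \<open>T\<close> for the first factor serves as the copy on which the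
  solution \<open>S\<close> for the second factor operates. So the combined map is a composition of
  bijections. For a fixed copy \<open>b\<close>, the first component of the product determines \<open>x\<close>, hence the
  label, and with a fixed label the second component determines \<open>y\<close>.
\<close>

lemma double_complete_mapping_Times:
  fixes A :: "'a set" and B :: "'b set"
  assumes "finite A" "finite B" "has_double_complete_mapping A f" "has_double_complete_mapping B g"
  shows "has_double_complete_mapping (A \<times> B) (\<lambda>(x, y) (x', y'). (f x x', g y y'))"
proof -
  obtain T :: "bool \<times> 'a \<Rightarrow> bool \<times> 'a" where T: "bij_betw T (UNIV \<times> A) (UNIV \<times> A)"
      and T_mem: "\<And>b x. x \<in> A \<Longrightarrow> snd (T (b, x)) \<in> A"
      and outT: "\<And>b. bij_betw (\<lambda>x. f x (snd (T (b, x)))) A A"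
    by (rule double_complete_mappingE[OF assms(3)]) (rule that)
  obtain S :: "bool \<times> 'b \<Rightarrow> bool \<times> 'b" where S: "bij_betw S (UNIV \<times> B) (UNIV \<times> B)"
      and S_mem: "\<And>b x. x \<in> B \<Longrightarrow> snd (S (b, x)) \<in> B"
      and outS: "\<And>b. bij_betw (\<lambda>x. g x (snd (S (b, x)))) B B"
    by (rule double_complete_mappingE[OF assms(4)]) (rule that)
  let ?op = "\<lambda>(x, y) (x', y'). (f x x', g y y')"
  define R where "R = (\<lambda>(b, x, y).
    (fst (S (fst (T (b, x)), y)), snd (T (b, x)), snd (S (fst (T (b, x)), y))))"
  have T_eq: "b = b' \<and> x = x'"
    if "T (b, x) = T (b', x')" "x \<in> A" "x' \<in> A" for b x b' x'
    using T that by (auto simp: bij_betw_def dest: inj_onD)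
  have S_eq: "b = b' \<and> x = x'"
    if "S (b, x) = S (b', x')" "x \<in> B" "x' \<in> B" for b x b' x'
    using S that by (auto simp: bij_betw_def dest: inj_onD)
  have "bij_betw R (UNIV \<times> A \<times> B) (UNIV \<times> A \<times> B)"
  proof (rule bij_betw_if_inj_on_card_eq)
    show "inj_on R (UNIV \<times> A \<times> B)"
    proof (rule inj_onI)
      fix u v assume "u \<in> UNIV \<times> A \<times> B" "v \<in> UNIV \<times> A \<times> B" "R u = R v"
      moreover obtain b x y b' x' y' where uv: "u = (b, x, y)" "v = (b', x', y')"
        by (metis surj_pair)
      ultimately have mem: "x \<in> A" "y \<in> B" "x' \<in> A" "y' \<in> B"
        and "S (fst (T (b, x)), y) = S (fst (T (b', x')), y')"
        and snd: "snd (T (b, x)) = snd (T (b', x'))"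
        by (simp_all add: R_def prod_eq_iff)
      then have "fst (T (b, x)) = fst (T (b', x')) \<and> y = y'"
        using S_eq by blast
      moreover from this snd have "T (b, x) = T (b', x')"
        by (simp add: prod_eq_iff)
      ultimately show "u = v"
        using T_eq mem uv by blast
    qed
    show "R ` (UNIV \<times> A \<times> B) \<subseteq> UNIV \<times> A \<times> B"
      using T_mem S_mem by (auto simp: R_def)
  qed (use assms in auto)
  moreover have "bij_betw (\<lambda>u. ?op u (snd (R (b, u)))) (A \<times> B) (A \<times> B)"
    for b
  proof (rule bij_betw_if_inj_on_card_eq)
    have inT: "x = x'" if "f x (snd (T (b, x))) = f x' (snd (T (b, x')))" "x \<in> A" "x' \<in> A" for x x'
      using outT[of b] that by (auto simp: bij_betw_def dest: inj_onD)
    have inS: "x = x'" if "g x (snd (S (c, x))) = g x' (snd (S (c, x')))" "x \<in> B" "x' \<in> B" for x x' c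
      using outS[of c] that by (auto simp: bij_betw_def dest: inj_onD)
    show "inj_on (\<lambda>u. ?op u (snd (R (b, u)))) (A \<times> B)"
    proof (rule inj_onI)
      fix u v assume "u \<in> A \<times> B" "v \<in> A \<times> B" "?op u (snd (R (b, u))) = ?op v (snd (R (b, v)))"
      moreover obtain x y x' y' where uv: "u = (x, y)" "v = (x', y')"
        by (metis surj_pair)
      ultimately have mem: "x \<in> A" "y \<in> B" "x' \<in> A" "y' \<in> B"
        and eqA: "f x (snd (T (b, x))) = f x' (snd (T (b, x')))"
        and eqB: "g y (snd (S (fst (T (b, x)), y))) = g y' (snd (S (fst (T (b, x')), y')))"
        by (simp_all add: R_def)
      have x: "x = x'"
        using inT[OF eqA] mem by blast
      have "y = y'"
        using inS[OF eqB[folded x]] mem by blast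
      with x uv show "u = v" by simp
    qed
    have memT: "f x (snd (T (b, x))) \<in> A" if "x \<in> A" for x
      using outT[of b] that by (auto simp: bij_betw_def)
    have memS: "g x (snd (S (c, x))) \<in> B" if "x \<in> B" for x c
      using outS[of c] that by (auto simp: bij_betw_def)
    show "(\<lambda>u. ?op u (snd (R (b, u)))) ` (A \<times> B) \<subseteq> A \<times> B"
      using memT memS by (auto simp: R_def)
  qed (use assms in auto)
  ultimately show ?thesis unfolding has_double_complete_mapping_def by blast
qed

text \<open>
  Doubling in the cyclic group of order \<open>2 k\<close> hits every even element twice, once from each
  half of \<open>{..<2 * k}\<close>. Adding \<open>1\<close> on one of the halves repairs this: take \<open>\<sigma> (b, x) = x + 1\<close> on one half and
  \<open>\<sigma> (b, x) = x\<close> on the other, with the halves exchanged between the two copies. Then \<open>\<sigma>\<close> takes each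
  value once as some \<open>x\<close> and once as some \<open>x + 1\<close>, and this distinction is the label \<open>c\<close>.
\<close>

lemma double_complete_mapping_add_mod:
  fixes k :: nat
  assumes "k > 0"
  shows "has_double_complete_mapping {..<2 * k} (\<lambda>x y. (x + y) mod (2 * k))"
proof -
  define T where "T = (\<lambda>(b, x). let c = (b = (x < k)) in (c, (x + of_bool c) mod (2 * k)))"
  have "bij_betw T (UNIV \<times> {..<2 * k}) (UNIV \<times> {..<2 * k})"
  proof (rule bij_betw_if_inj_on_card_eq)
    show "inj_on T (UNIV \<times> {..<2 * k})"
    proof (rule inj_onI, clarify)
      fix b x b' x'
      assume mem: "x < 2 * k" "x' < 2 * k" and eq: "T (b, x) = T (b', x')"
      then have c: "(b = (x < k)) = (b' = (x' < k))"
        by (simp add: T_def Let_def)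
      with eq have "[x + of_bool (b = (x < k)) = x' + of_bool (b = (x < k))] (mod 2 * k)"
        by (simp add: T_def Let_def cong_def)
      then have "x = x'"
        using mem by (simp add: cong_add_rcancel_nat cong_less_modulus_unique_nat)
      with c show "b = b' \<and> x = x'" by auto
    qed
  qed (use assms in \<open>auto simp: T_def Let_def\<close>)
  moreover have "bij_betw (\<lambda>x. (x + snd (T (b, x))) mod (2 * k)) {..<2 * k} {..<2 * k}" for b
  proof (rule bij_betw_if_inj_on_card_eq)
    have out: "(x + snd (T (b, x))) mod (2 * k) =
        2 * (if x < k then x else x - k) + of_bool (b = (x < k))" if "x < 2 * k" for x
    proof -
      have "(x + snd (T (b, x))) mod (2 * k) = (2 * x + of_bool (b = (x < k))) mod (2 * k)"
        by (simp add: T_def Let_def mod_simps mult_2)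
      also have "\<dots> = 2 * (if x < k then x else x - k) + of_bool (b = (x < k))"
      proof (cases "x < k")
        case False
        then have "2 * x + of_bool (b = (x < k)) = 2 * (x - k) + of_bool (b = (x < k)) + 2 * k"
          by simp
        then have "(2 * x + of_bool (b = (x < k))) mod (2 * k) =
            (2 * (x - k) + of_bool (b = (x < k))) mod (2 * k)"
          by (simp only: mod_add_self2)
        also have "\<dots> = 2 * (x - k) + of_bool (b = (x < k))"
          by (rule mod_less) (use that False in \<open>auto simp: of_bool_def\<close>)
        finally show ?thesis using False by simp
      qed (auto simp: of_bool_def)
      finally show ?thesis .
    qed
    show "inj_on (\<lambda>x. (x + snd (T (b, x))) mod (2 * k)) {..<2 * k}"
    proof (rule inj_onI)
      fix x y assume "x \<in> {..<2 * k}" "y \<in> {..<2 * k}"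
        "(x + snd (T (b, x))) mod (2 * k) = (y + snd (T (b, y))) mod (2 * k)"
      then have "2 * (if x < k then x else x - k) + (of_bool (b = (x < k)) :: nat) =
          2 * (if y < k then y else y - k) + of_bool (b = (y < k))" "x < 2 * k" "y < 2 * k"
        by (auto simp: out)
      then show "x = y"
        by (cases b; cases "x < k"; cases "y < k") (auto, presburger+)
    qed
  qed (use assms in auto)
  ultimately show ?thesis unfolding has_double_complete_mapping_def by blast
qed

text \<open>
  By a primitive root, the units are a cyclic group of even order, unless \<open>q = 2\<close>.
\<close>

lemma double_complete_mapping_mult_mod_prime:
  fixes q :: nat
  assumes "prime q"
  shows "has_double_complete_mapping {..<q} (\<lambda>x y. x * y mod q)"
proof -
  obtain g where g: "residue_primroot q g"
    using prime_primitive_root_exists assms by (metis cyclic_moduli_def prime_gt_1_nat)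
  have gt: "q > 1" using prime_gt_1_nat[OF assms] .
  have "has_double_complete_mapping (totatives q) (\<lambda>x y. x * y mod q)"
  proof (cases "q = 2")
    case True
    have "bij_betw (\<lambda>x. x * snd (id (b :: bool, x)) mod q) {1} {1}" for b
      using True by (auto simp: bij_betw_def)
    moreover have "totatives q = {1}"
      using True by (auto simp: totatives_prime)
    ultimately show ?thesis
      unfolding has_double_complete_mapping_def using bij_betw_id by metis
  next
    case False
    then have "odd q" using assms primes_dvd_imp_eq two_is_prime_nat by blast
    then obtain k where k: "q - 1 = 2 * k" by (metis dvd_def odd_two_times_div_two_nat)
    with gt have "k > 0" by auto
    show ?thesis
    proof (rule double_complete_mapping_image[OF double_complete_mapping_add_mod[OF \<open>k > 0\<close>]])
      show "bij_betw (\<lambda>i. g ^ i mod q) {..<2 * k} (totatives q)"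
        using residue_primroot_is_generator[OF gt g] k by (simp add: totient_prime[OF assms])
    next
      fix x y
      have "[g ^ ((x + y) mod (2 * k)) = g ^ (x + y)] (mod q)"
        unfolding primroot_power_cong_iff[OF assms g] k by (simp add: cong_def)
      then show "g ^ ((x + y) mod (2 * k)) mod q = (g ^ x mod q) * (g ^ y mod q) mod q"
        by (simp add: cong_def power_add mod_mult_eq)
    qed
  qed
  moreover have "insert 0 (totatives q) = {..<q}"
    using gt by (auto simp: totatives_prime[OF assms])
  ultimately show ?thesis
    using double_complete_mapping_insert[of "totatives q" "\<lambda>x y. x * y mod q" 0] by simp
qed

lemma double_complete_mapping_mult_mod_coprime:
  fixes a b :: nat
  assumes "coprime a b" "a > 0" "b > 0"
    and "has_double_complete_mapping {..<a} (\<lambda>x y. x * y mod a)"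
    and "has_double_complete_mapping {..<b} (\<lambda>x y. x * y mod b)"
  shows "has_double_complete_mapping {..<a * b} (\<lambda>x y. x * y mod (a * b))"
proof -
  let ?h = "\<lambda>x. (x mod a, x mod b)"
  have bij: "bij_betw ?h {..<a * b} ({..<a} \<times> {..<b})"
    using assms(2,3) inj_on_mod_coprime[OF assms(1)] by (intro bij_betw_if_inj_on_card_eq) auto
  define w where "w = inv_into {..<a * b} ?h"
  have w: "bij_betw w ({..<a} \<times> {..<b}) {..<a * b}"
    unfolding w_def by (rule bij_betw_inv_into[OF bij])
  have h_w: "?h (w u) = u" if "u \<in> {..<a} \<times> {..<b}" for u
    unfolding w_def using bij_betw_inv_into_right[OF bij that] .
  show ?thesis
  proof (rule double_complete_mapping_image[OF double_complete_mapping_Times[OF _ _ assms(4,5)] w])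
    fix u v assume u: "u \<in> {..<a} \<times> {..<b}" and v: "v \<in> {..<a} \<times> {..<b}"
    define uv where "uv = (\<lambda>(x, y) (x', y'). (x * x' mod a, y * y' mod b)) u v"
    have uv: "uv \<in> {..<a} \<times> {..<b}"
      using assms(2,3) by (auto simp: uv_def split: prod.splits)
    have "?h (w u * w v mod (a * b)) =
        (fst (?h (w u)) * fst (?h (w v)) mod a, snd (?h (w u)) * snd (?h (w v)) mod b)"
      by (simp add: mod_mod_cancel mod_mult_eq)
    also have "\<dots> = uv"
      unfolding h_w[OF u] h_w[OF v] by (simp add: uv_def split_beta)
    finally have "?h (w uv) = ?h (w u * w v mod (a * b))"
      using h_w[OF uv] by simp
    moreover have "w uv \<in> {..<a * b}"
      using w uv by (auto simp: bij_betw_def)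
    ultimately show "w uv = w u * w v mod (a * b)"
      using bij assms(2,3) by (auto simp: bij_betw_def dest: inj_onD)
  qed auto
qed

lemma double_complete_mapping_mult_mod_squarefree:
  fixes N :: nat
  assumes "squarefree N"
  shows "has_double_complete_mapping {..<N} (\<lambda>x y. x * y mod N)"
  using assms
proof (induction N rule: less_induct)
  case (less N)
  show ?case
  proof (cases "N = 1")
    case True
    then show ?thesis
      unfolding has_double_complete_mapping_def
      by (intro exI[of _ id] conjI allI bij_betw_id) (simp add: bij_betw_def lessThan_Suc)
  next
    case False
    then obtain q where q: "prime q" "q dvd N" using prime_factor_nat by blast
    then obtain m where N: "N = q * m" by blast
    have coprime: "coprime q m" and sf: "squarefree m"
      using less.prems N coprime_if_squarefree_mult squarefree_multD by blast+
    have m: "m > 0" "m < N"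
      using less.prems N prime_gt_1_nat[OF q(1)] by (auto intro!: Nat.gr0I)
    show ?thesis
      unfolding N
      by (rule double_complete_mapping_mult_mod_coprime[OF coprime prime_gt_0_nat[OF q(1)] m(1)
            double_complete_mapping_mult_mod_prime[OF q(1)] less.IH[OF m(2) sf]])
  qed
qed

section \<open>Sufficiency\<close>

text \<open>
  A unit \<open>r\<close> modulo \<open>p\<close> is given by its parity and its discrete logarithm. The map \<open>T\<close> turns this
  pair into a label and a multiplier modulo \<open>N = p - 1\<close>, which \<open>lift\<close> encodes as an exponent in
  \<open>{1..2 * N}\<close>. The two exponents \<open>2 p - 1\<close> and \<open>2 p\<close> that are left over go to the residues \<open>p\<close> and
  \<open>0\<close>, which every positive power fixes.
\<close>

lemma nice_double_prime:
  assumes "prime p" "odd p" "squarefree (p - 1)"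
  shows "nice (2 * p)"
proof -
  define N where "N = p - 1"
  have "p \<ge> 3" using assms(1,2) prime_ge_2_nat[of p] by (cases "p = 2") auto
  then have N: "N > 0" "2 * p = 2 * N + 2" by (auto simp: N_def)
  obtain T :: "bool \<times> nat \<Rightarrow> bool \<times> nat" where T: "bij_betw T (UNIV \<times> {..<N}) (UNIV \<times> {..<N})"
      and T_mem': "\<And>b x. x \<in> {..<N} \<Longrightarrow> snd (T (b, x)) \<in> {..<N}"
      and out: "\<And>b. bij_betw (\<lambda>x. x * snd (T (b, x)) mod N) {..<N} {..<N}"
    by (rule double_complete_mappingE[OF double_complete_mapping_mult_mod_squarefree[OF
          assms(3)[folded N_def]]]) (rule that)
  obtain g where g: "residue_primroot p g"
    using prime_primitive_root_exists assms(1) by (metis cyclic_moduli_def prime_gt_1_nat)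
  define dlog where "dlog r = (SOME i. i < N \<and> [g ^ i = r] (mod p))" for r
  have dlog: "dlog r < N" "[g ^ dlog r = r] (mod p)" if "\<not> p dvd r" for r
    using someI_ex[of "\<lambda>i. i < N \<and> [g ^ i = r] (mod p)"] primroot_power_cong[OF assms(1) g that]
    unfolding dlog_def N_def by blast+
  \<comment> \<open>Exponents must be positive, so the residue \<open>0\<close> modulo \<open>N\<close> is represented by \<open>N\<close>.\<close>
  define lift where "lift = (\<lambda>(c, a). (if a = 0 then N else a) + (if c then N else 0))"
  define e where "e r = (if r = 0 then 2 * p else if r = p then 2 * p - 1
     else lift (T (odd r, dlog r)))" for r
  have lift_mod: "[lift u = snd u] (mod N)" for u
    by (cases u) (auto simp: lift_def cong_def)
  have lift_mem: "lift u \<in> {1..2 * N}" if "snd u < N" for u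
    using that by (cases u) (auto simp: lift_def)
  have lift_inj: "u = v" if "lift u = lift v" "snd u < N" "snd v < N" for u v
    using that by (cases u; cases v) (auto simp: lift_def split: if_splits)
  have dvd_iff: "p dvd r \<longleftrightarrow> r = 0 \<or> r = p" if "r < 2 * p" for r
    using that by (auto elim!: dvdE)
  have eqI: "r = s" if "r < 2 * p" "s < 2 * p" "odd r = odd s" "[r = s] (mod p)" for r s
  proof -
    have "[r = s] (mod 2)" using that(3) by (simp add: cong_def mod2_eq_if)
    then have "[r = s] (mod 2 * p)"
      using that(4) assms(2) by (intro coprime_cong_mult_nat) auto
    then show ?thesis using that(1,2) cong_less_modulus_unique_nat by blast
  qed
  have T_mem: "snd (T (b, x)) < N" if "x < N" for b x
    using T_mem'[of x b] that by simp
  have e_lift: "e r = lift (T (odd r, dlog r))" if "\<not> p dvd r" "r < 2 * p" for r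
    using that dvd_iff[of r] by (auto simp: e_def)
  have e_unit: "e r \<in> {1..2 * N}" "[e r = snd (T (odd r, dlog r))] (mod N)"
    if "\<not> p dvd r" "r < 2 * p" for r
    using lift_mem[OF T_mem[OF dlog(1)[OF that(1)]]] lift_mod e_lift[OF that] by simp_all
  have e_pos: "e r > 0" if "r < 2 * p" for r
    using e_unit(1)[of r] that dvd_iff[of r] \<open>p \<ge> 3\<close> by (auto simp: e_def)
  have "bij_betw e {..<2 * p} {1..2 * p}"
  proof (rule bij_betw_if_inj_on_card_eq)
    show "e ` {..<2 * p} \<subseteq> {1..2 * p}"
    proof clarify
      fix r assume "r < 2 * p"
      then show "e r \<in> {1..2 * p}"
        using e_unit(1)[of r] dvd_iff[of r] N \<open>p \<ge> 3\<close> by (auto simp: e_def)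
    qed
    show "inj_on e {..<2 * p}"
    proof (rule inj_onI)
      fix r s assume "r \<in> {..<2 * p}" "s \<in> {..<2 * p}" and eq: "e r = e s"
      then have less: "r < 2 * p" "s < 2 * p" by auto
      have big: "e u \<le> 2 * N \<longleftrightarrow> \<not> p dvd u" if "u < 2 * p" for u
        using e_unit(1)[of u] that dvd_iff[of u] N(2) by (auto simp: e_def)
      show "r = s"
      proof (cases "p dvd r")
        case True
        then have "p dvd s" using big eq less by metis
        then show ?thesis
          using True eq less dvd_iff \<open>p \<ge> 3\<close> by (auto simp: e_def split: if_splits)
      next
        case False
        then have "\<not> p dvd s" using big eq less by metis
        note units = False this
        have "lift (T (odd r, dlog r)) = lift (T (odd s, dlog s))"
          using eq e_lift[OF units(1) less(1)] e_lift[OF units(2) less(2)] by simp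
        then have "T (odd r, dlog r) = T (odd s, dlog s)"
          using lift_inj T_mem dlog(1) units by blast
        then have "(odd r, dlog r) = (odd s, dlog s)"
          by (rule inj_onD[OF bij_betw_imp_inj_on[OF T]]) (use dlog(1) units in simp_all)
        then have "odd r = odd s" and dlog_eq: "dlog r = dlog s" by simp_all
        moreover have "[r = s] (mod p)"
          using dlog(2)[OF units(1)] dlog(2)[OF units(2)] unfolding dlog_eq
          by (meson cong_sym cong_trans)
        ultimately show ?thesis using eqI less by blast
      qed
    qed
  qed auto
  moreover have "inj_on (\<lambda>r. r ^ e r mod (2 * p)) {..<2 * p}"
  proof (rule inj_onI)
    fix r s assume "r \<in> {..<2 * p}" "s \<in> {..<2 * p}" and eq: "r ^ e r mod (2 * p) = s ^ e s mod (2 * p)"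
    then have less: "r < 2 * p" "s < 2 * p" by auto
    have cong: "[r ^ e r = s ^ e s] (mod 2 * p)" using eq by (simp add: cong_def)
    then have cong_p: "[r ^ e r = s ^ e s] (mod p)" and cong_2: "[r ^ e r = s ^ e s] (mod 2)"
      by (auto intro: cong_dvd_modulus_nat)
    have "odd (r ^ e r) = odd (s ^ e s)"
      by (rule arg_cong[where f = Not, OF cong_dvd_iff[OF cong_2]])
    then have parity: "odd r = odd s"
      using e_pos less by auto
    have dvd_pow: "p dvd u ^ e u \<longleftrightarrow> p dvd u" if "u < 2 * p" for u
      using e_pos[OF that] assms(1) by (simp add: prime_dvd_power_iff)
    have dvd: "p dvd r \<longleftrightarrow> p dvd s"
      using dvd_pow less cong_dvd_iff[OF cong_p] by simp
    have "[r = s] (mod p)"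
    proof (cases "p dvd r")
      case True
      then show ?thesis using dvd by (simp add: cong_def)
    next
      case False
      then have units: "\<not> p dvd r" "\<not> p dvd s" using dvd by auto
      have pow: "[u ^ e u = g ^ (dlog u * snd (T (odd u, dlog u)))] (mod p)"
        if "\<not> p dvd u" "u < 2 * p" for u
      proof -
        have "[u ^ e u = (g ^ dlog u) ^ e u] (mod p)"
          using dlog(2)[OF that(1)] by (intro cong_pow) (rule cong_sym)
        moreover have "[g ^ (dlog u * e u) = g ^ (dlog u * snd (T (odd u, dlog u)))] (mod p)"
          unfolding primroot_power_cong_iff[OF assms(1) g]
          unfolding N_def[symmetric] by (rule cong_scalar_left[OF e_unit(2)[OF that]])
        ultimately show ?thesis
          by (metis cong_trans power_mult)
      qed
      have "[g ^ (dlog r * snd (T (odd r, dlog r))) = g ^ (dlog s * snd (T (odd s, dlog s)))] (mod p)"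
        using pow[OF units(1) less(1)] pow[OF units(2) less(2)] cong_p
        by (meson cong_sym cong_trans)
      then have "[dlog r * snd (T (odd r, dlog r)) = dlog s * snd (T (odd r, dlog s))] (mod N)"
        unfolding primroot_power_cong_iff[OF assms(1) g] N_def parity .
      then have dlog_eq: "dlog r = dlog s"
        unfolding cong_def
        by (rule inj_onD[OF bij_betw_imp_inj_on[OF out]]) (use dlog(1) units in simp_all)
      show ?thesis
        using dlog(2)[OF units(1)] dlog(2)[OF units(2)] unfolding dlog_eq
        by (meson cong_sym cong_trans)
    qed
    then show "r = s" using eqI less parity by blast
  qed
  moreover have "2 * p \<ge> 2" using \<open>p \<ge> 3\<close> by simp
  ultimately show ?thesis
    unfolding nice_iff_inj_on by blast
qed

theorem theorem1p3:
  fixes n :: nat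
  assumes "n \<ge> 6" and "even n"
  shows "nice n \<longleftrightarrow> prime (n div 2) \<and> squarefree (n div 2 - 1)"
proof -
  have n: "n = 2 * (n div 2)" using assms(2) by simp
  have odd: "odd (n div 2)" if "prime (n div 2)"
    using that assms(1) primes_dvd_imp_eq[OF two_is_prime_nat that] by auto
  show ?thesis
  proof
    assume "nice n"
    then have "prime (n div 2)" using assms by (rule prime_half_if_nice)
    then show "prime (n div 2) \<and> squarefree (n div 2 - 1)"
      using squarefree_half_minus_1_if_nice[of "n div 2"] \<open>nice n\<close> n odd by simp
  next
    assume "prime (n div 2) \<and> squarefree (n div 2 - 1)"
    then show "nice n"
      using nice_double_prime[of "n div 2"] n odd by simp
  qed
qed

end
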